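(* Let $r\ge 1$ and let $\vec a,\vec b\in(-1,\infty)^r$ satisfy $a_j<b_j$ for $1\le j\le r$. Let $\vec n$ be a multi-index near the diagonal with $|\vec n|\ge 1$. Then every type I function $F_{\vec n}$ for the weights $(w_1,\dots,w_r)$ on $(0,1)$ has a Mellin transform of the form $$\int_0^1 F_{\vec n}(x)x^{s-1}\,dx=\mathcal F_{\vec n}\cdot\frac{\Gamma(s+\vec a)}{\Gamma(s+\vec b+\vec n)}\,(1-s)_{|\vec n|-1}$$ for some constant $\mathcal F_{\vec n}\in\mathbb R$.
   Context: Conventions: for a vector $\vec s=(s_1,\dots,s_r)$, $\Gamma(\vec s)=\prod_j\Gamma(s_j)$; adding a scalar to a vector means adding it to each component. $(s)_k=\prod_{i=0}^{k-1}(s+i)$. $|\vec n|=n_1+\dots+n_r$. $\vec e_j$ is the $j$-th unit vector. A multi-index $\vec n\in\mathbb Z_{\ge0}^r$ is near the diagonal if $|n_i-n_j|\le 1$ for all $i,j$. Weights: for parameters $a_j<b_j$, let $\mathcal B^{a,b}(x)=x^a(1-x)^{b-a-1}/\Gamma(b-a)$ on $(0,1)$ (and $0$ elsewhere), and let $w_0(x;\vec a,\vec b)$ be the Mellin convolution $\mathcal B^{a_1,b_1}\ast\dots\ast\mathcal B^{a_r,b_r}$, where $(f\ast g)(x)=\int_0^\infty f(t)g(x/t)\,dt/t$. It is supported on $[0,1]$ and has Mellin transform $\int_0^1x^{s-1}w_0\,dx=\Gamma(s+\vec a)/\Gamma(s+\vec b)$. Put $w_j(x)=w_j(x;\vec a,\vec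 b)=w_0(x;\vec a,\vec b+\vec e_j)$, $1\le j\le r$, so $w_j$ has Mellin transform $\Gamma(s+\vec a)/\Gamma(s+\vec b+\vec e_j)$. The Mellin transforms are considered for $\mathrm{Re}\,s>-\min_j a_j$. Type I function: $F_{\vec n}=\sum_{j=1}^rA_{\vec n,j}w_j$ where $A_{\vec n,j}$ are real polynomials with $\deg A_{\vec n,j}\le n_j-1$ (so $A_{\vec n,j}=0$ if $n_j=0$) and $\int_0^1F_{\vec n}(x)x^k\,dx=0$ for $k=0,\dots,|\vec n|-2$. *)

theory Defs
  imports "HOL-Analysis.Analysis" "HOL-Computational_Algebra.Polynomial"
begin

text \<open>
  Vectors \<open>v = (v\<^sub>1, \<dots>, v\<^sub>r)\<close> are functions on \<^typ>\<open>nat\<close> of which only the values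
  at the indices in \<open>{1..r}\<close> matter.
\<close>

definition beta_fun :: "real \<Rightarrow> real \<Rightarrow> real \<Rightarrow> real" where
  "beta_fun a b x =
     (if 0 < x \<and> x < 1 then x powr a * (1 - x) powr (b - a - 1) / Gamma (b - a) else 0)"

definition mellin_conv :: "(real \<Rightarrow> real) \<Rightarrow> (real \<Rightarrow> real) \<Rightarrow> real \<Rightarrow> real" where
  "mellin_conv f g x = (LINT t:{0<..}|lborel. f t * g (x / t) / t)"

text \<open>
  The \<open>r\<close>-fold convolution is bracketed to the left; it is meant for \<open>r \<ge> 1\<close> only.
\<close>

definition weight0 :: "nat \<Rightarrow> (nat \<Rightarrow> real) \<Rightarrow> (nat \<Rightarrow> real) \<Rightarrow> real \<Rightarrow> real" where
  "weight0 r a b =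
     foldl mellin_conv (beta_fun (a 1) (b 1)) (map (\<lambda>j. beta_fun (a j) (b j)) [2..<Suc r])"

definition weight :: "nat \<Rightarrow> (nat \<Rightarrow> real) \<Rightarrow> (nat \<Rightarrow> real) \<Rightarrow> nat \<Rightarrow> real \<Rightarrow> real" where
  "weight r a b j = weight0 r a (b(j := b j + 1))"

definition near_diagonal :: "nat \<Rightarrow> (nat \<Rightarrow> nat) \<Rightarrow> bool" where
  "near_diagonal r n \<longleftrightarrow> (\<forall>i\<in>{1..r}. \<forall>j\<in>{1..r}. \<bar>int (n i) - int (n j)\<bar> \<le> 1)"

definition multi_size :: "nat \<Rightarrow> (nat \<Rightarrow> nat) \<Rightarrow> nat" where
  "multi_size r n = (\<Sum>j=1..r. n j)"

text \<open>
  The degree bound \<open>deg A\<^sub>j \<le> n\<^sub>j - 1\<close> (with \<open>A\<^sub>j = 0\<close> if \<open>n\<^sub>j = 0\<close>) and the range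
  \<open>k \<le> |n| - 2\<close> are written without truncated subtraction.  The zero function
  is admitted.  Only the values of \<open>F\<close> on the open unit interval are constrained.
\<close>

definition type_I_function ::
  "nat \<Rightarrow> (nat \<Rightarrow> real \<Rightarrow> real) \<Rightarrow> (nat \<Rightarrow> nat) \<Rightarrow> (real \<Rightarrow> real) \<Rightarrow> bool" where
  "type_I_function r w n F \<longleftrightarrow>
     (\<exists>A :: nat \<Rightarrow> real poly.
        (\<forall>j\<in>{1..r}. A j = 0 \<or> degree (A j) < n j) \<and>
        (\<forall>x\<in>{0<..<1}. F x = (\<Sum>j=1..r. poly (A j) x * w j x))) \<and>
     (\<forall>k. k + 2 \<le> multi_size r n \<longrightarrow> (LINT x:{0<..<1}|lborel. F x * x ^ k) = 0)"

text \<open>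
  The Mellin transform over the open unit interval, as convergence with a value: the
  Lebesgue integral on its own would be \<open>0\<close> where it does not converge.
\<close>

definition has_mellin_transform_at :: "(real \<Rightarrow> real) \<Rightarrow> complex \<Rightarrow> complex \<Rightarrow> bool" where
  "has_mellin_transform_at F s v \<longleftrightarrow>
     set_integrable lborel {0<..<1} (\<lambda>x. complex_of_real (F x) * complex_of_real x powr (s - 1)) \<and>
     (LINT x:{0<..<1}|lborel. complex_of_real (F x) * complex_of_real x powr (s - 1)) = v"

end

theory Submission
  imports Defs "HOL-Complex_Analysis.Cauchy_Integral_Theorem"
begin

text \<open>
  Multiplying \<open>w\<^sub>j\<close> by \<open>x\<^sup>k\<close> shifts the argument of its Mellin transform by \<open>k\<close>.  Near the
  diagonal, \<open>k < n\<^sub>j\<close> gives \<open>k + \<delta>\<^sub>i\<^sub>j \<le> n\<^sub>i\<close> for all \<open>i\<close>, so the shifted transform is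
  \<open>\<Gamma>(s + a) / \<Gamma>(s + b + n)\<close> times a product of Pochhammer symbols, a polynomial in \<open>s\<close> of degree
  \<open>|n| - 1\<close>.  Hence the Mellin transform of \<open>F\<close> is \<open>\<Gamma>(s + a) / \<Gamma>(s + b + n) P(s)\<close> with
  \<open>deg P \<le> |n| - 1\<close>, and orthogonality says that \<open>P\<close> vanishes at \<open>1, \<dots>, |n| - 1\<close>.

  The transforms of the weights come from the multiplicativity of the Mellin transform under
  convolution and from the Beta integral with a complex exponent, obtained by integrating the
  additive convolution of two Gamma integrands.
\<close>

section \<open>Measurability, nonvanishing of Gamma, and a form of Fubini's theorem\<close>

lemma borel_measurable_of_real_powr [measurable]:
  assumes [measurable]: "f \<in> borel_measurable M"
  shows "(\<lambda>x. complex_of_real (f x) powr z) \<in> borel_measurable M"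
  unfolding powr_def by measurable

text \<open>\<open>Gamma\<close> is totalised to be 0 exactly at its poles, the nonpositive
  integers, and none of these has positive real part.\<close>

lemma Gamma_nonzero_right_half_plane:
  assumes "Re z > 0"
  shows "Gamma z \<noteq> 0"
proof
  assume "Gamma z = 0"
  then obtain n where "z = - of_nat n"
    by (auto simp: Gamma_eq_zero_iff elim: nonpos_Ints_cases')
  with assms show False by simp
qed

text \<open>Serves both the additive and the multiplicative convolution: in each, integrating out
  \<open>w\<close> leaves \<open>\<phi> u\<close> times a constant independent of \<open>u\<close>.
  The same holds for norms, so the iterated integral of the norm is finite, which gives joint
  integrability.\<close>

lemma has_bochner_integral_Fubini:
  fixes H :: "real \<Rightarrow> real \<Rightarrow> complex"
  assumes meas: "case_prod H \<in> borel_measurable (lborel \<Otimes>\<^sub>M lborel)"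
    and inner: "\<And>u. has_bochner_integral lborel (H u) (\<phi> u * K)"
    and inner_norm: "\<And>u. (\<integral>w. norm (H u w) \<partial>lborel) = norm (\<phi> u) * K'"
    and outer: "has_bochner_integral lborel \<phi> L"
  shows "has_bochner_integral lborel (\<lambda>w. \<integral>u. H u w \<partial>lborel) (L * K)"
proof -
  have int: "integrable (lborel \<Otimes>\<^sub>M lborel) (case_prod H)"
  proof (rule lborel_pair.Fubini_integrable)
    show "integrable lborel (\<lambda>u. \<integral>w. norm (case_prod H (u, w)) \<partial>lborel)"
      using outer by (simp add: inner_norm has_bochner_integral_iff)
    show "AE u in lborel. integrable lborel (\<lambda>w. case_prod H (u, w))"
      using inner by (simp add: has_bochner_integral_iff)
  qed (rule meas)
  have "(\<integral>w. \<integral>u. H u w \<partial>lborel \<partial>lborel) = (\<integral>u. \<integral>w. H u w \<partial>lborel \<partial>lborel)"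
    using lborel_pair.integral_snd[OF int] lborel_pair.integral_fst[OF int] by simp
  also have "\<dots> = (\<integral>u. \<phi> u * K \<partial>lborel)"
    using inner by (simp add: has_bochner_integral_iff)
  also have "\<dots> = L * K"
    using outer by (simp add: has_bochner_integral_iff)
  finally show ?thesis
    using lborel_pair.integrable_snd[OF int] by (simp add: has_bochner_integral_iff)
qed

section \<open>The Beta integral with complex parameters\<close>

definition gamma_kernel :: "complex \<Rightarrow> real \<Rightarrow> complex" where
  "gamma_kernel z t = indicator {0<..} t * (of_real t powr (z - 1) / of_real (exp t))"

lemma borel_measurable_gamma_kernel [measurable]: "gamma_kernel z \<in> borel_measurable borel"
  unfolding gamma_kernel_def by measurable

lemma has_bochner_integral_gamma_kernel:
  assumes "Re z > 0"
  shows "has_bochner_integral lborel (gamma_kernel z) (Gamma z)"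
proof -
  have eq: "gamma_kernel z = (\<lambda>t. indicator {0<..} t *\<^sub>R (of_real t powr (z - 1) / of_real (exp t)))"
    by (auto simp: gamma_kernel_def fun_eq_iff indicator_def)
  have "integrable lebesgue (gamma_kernel z)"
    using absolutely_integrable_Gamma_integral'[OF assms] by (simp add: set_integrable_def eq)
  \<comment> \<open>The Gamma integral is available over \<open>lebesgue\<close>, the completion of
    \<open>lborel\<close>; Borel measurability brings it down.\<close>
  then have int: "integrable lborel (gamma_kernel z)"
    by (subst (asm) integrable_completion) auto
  moreover have "integral\<^sup>L lborel (gamma_kernel z) = Gamma z"
    using set_borel_integral_eq_integral(2)[of "{0<..}" "\<lambda>t. of_real t powr (z - 1) / of_real (exp t)"]
      int Gamma_integral_complex'[OF assms]
    by (simp add: set_integrable_def set_lebesgue_integral_def eq integral_unique)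
  ultimately show ?thesis by (simp add: has_bochner_integral_iff)
qed

definition beta_kernel :: "complex \<Rightarrow> complex \<Rightarrow> real \<Rightarrow> complex" where
  "beta_kernel z c t = indicator {0<..<1} t * (of_real t powr (z - 1) * of_real (1 - t) powr (c - 1))"

lemma borel_measurable_beta_kernel [measurable]: "beta_kernel z c \<in> borel_measurable borel"
  unfolding beta_kernel_def by measurable

text \<open>On the open interval the norm of the integrand is the real Beta integrand at the real
  parts of the parameters.\<close>

lemma integrable_beta_kernel:
  assumes "Re z > 0" "Re c > 0"
  shows "integrable lborel (beta_kernel z c)"
proof (rule Bochner_Integration.integrable_bound)
  show "integrable lborel (\<lambda>t. indicator {0..1} t *\<^sub>R (t powr (Re z - 1) * (1 - t) powr (Re c - 1)))"
    using integrable_Beta[OF assms] by (simp add: set_integrable_def)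
  show "AE t in lborel. norm (beta_kernel z c t)
      \<le> norm (indicat_real {0..1} t *\<^sub>R (t powr (Re z - 1) * (1 - t) powr (Re c - 1)))"
    by (intro AE_I2)
      (auto simp: beta_kernel_def indicator_def norm_mult norm_powr_real_powr simp del: of_real_diff)
qed measurable

text \<open>Substitute u = w t: the exponentials combine to exp w and the powers of w to the
  exponent z + c - 1, leaving the Beta integrand in t. For w \<le> 0 both sides vanish, since u > 0
  and w - u > 0 cannot hold together.\<close>

lemma gamma_kernel_convolution:
  "(\<integral>u. gamma_kernel z u * gamma_kernel c (w - u) \<partial>lborel)
     = gamma_kernel (z + c) w * (\<integral>t. beta_kernel z c t \<partial>lborel)"
proof (cases "w > 0")
  case False
  then have *: "gamma_kernel z u * gamma_kernel c (w - u) = 0" for u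
    by (auto simp: gamma_kernel_def indicator_def)
  show ?thesis using False unfolding * by (simp add: gamma_kernel_def)
next
  case w: True
  \<comment> \<open>The division by w is undone by the Jacobian of u = w t.\<close>
  have *: "gamma_kernel z (w * t) * gamma_kernel c (w - w * t)
      = gamma_kernel (z + c) w / of_real w * beta_kernel z c t" for t
  proof (cases "0 < t \<and> t < 1")
    case True
    then have "w * t < w" using w by simp
    moreover have "of_real (w - w * t) powr (c - 1)
        = of_real w powr (c - 1) * of_real (1 - t) powr (c - 1)"
      using True w by (subst powr_times_real [symmetric]) (auto simp: algebra_simps)
    moreover have "of_real (w * t) powr (z - 1) = of_real w powr (z - 1) * complex_of_real t powr (z - 1)"
      using True w by (simp add: powr_times_real)
    moreover have "of_real w powr (z + c - 1) = of_real w powr (z - 1) * of_real w powr (c - 1) * complex_of_real w"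
      using w by (simp add: powr_add powr_diff)
    moreover have "exp (w * t) * exp (w - w * t) = exp w"
      by (simp flip: exp_add)
    then have "complex_of_real (exp (w * t)) * of_real (exp (w - w * t)) = of_real (exp w)"
      by (simp flip: of_real_mult)
    ultimately show ?thesis
      using True w by (simp add: gamma_kernel_def beta_kernel_def field_simps del: of_real_mult of_real_diff)
  next
    case False
    then have "\<not> (0 < w * t \<and> w * t < w)" using w by (simp add: zero_less_mult_iff)
    then show ?thesis using False
      by (auto simp: gamma_kernel_def beta_kernel_def indicator_def)
  qed
  have "(\<integral>u. gamma_kernel z u * gamma_kernel c (w - u) \<partial>lborel)
     = \<bar>w\<bar> *\<^sub>R (\<integral>t. gamma_kernel z (0 + w * t) * gamma_kernel c (w - (0 + w * t)) \<partial>lborel)"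
    using w by (intro lborel_integral_real_affine) auto
  also have "\<dots> = w *\<^sub>R (\<integral>t. gamma_kernel (z + c) w / of_real w * beta_kernel z c t \<partial>lborel)"
    using w by (simp only: add_0 *) simp
  also have "\<dots> = gamma_kernel (z + c) w * (\<integral>t. beta_kernel z c t \<partial>lborel)"
    using w by (simp add: scaleR_conv_of_real)
  finally show ?thesis .
qed

text \<open>The integral of the convolution of two Gamma integrands is computed twice: Fubini gives
  the product of the two Gamma values, and \<open>gamma_kernel_convolution\<close> gives
  \<open>Gamma (z + c)\<close> times the Beta integral. Divide by
  \<open>Gamma (z + c)\<close>.\<close>

lemma has_bochner_integral_beta_kernel:
  assumes "Re z > 0" "Re c > 0"
  shows "has_bochner_integral lborel (beta_kernel z c) (Beta z c)"
proof -
  have shift: "has_bochner_integral lborel (\<lambda>w. gamma_kernel c (w - u)) (Gamma c)" for u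
    using lborel_has_bochner_integral_real_affine_iff[of 1 "gamma_kernel c" "Gamma c" "- u"]
      has_bochner_integral_gamma_kernel[OF assms(2)] by simp
  have shift_norm: "(\<integral>w. norm (gamma_kernel c (w - u)) \<partial>lborel) = (\<integral>w. norm (gamma_kernel c w) \<partial>lborel)" for u
    using lborel_integral_real_affine[of 1 "\<lambda>w. norm (gamma_kernel c w)" "- u"] by simp
  have "has_bochner_integral lborel
      (\<lambda>w. \<integral>u. gamma_kernel z u * gamma_kernel c (w - u) \<partial>lborel) (Gamma z * Gamma c)"
  proof (rule has_bochner_integral_Fubini)
    show "(\<lambda>(u, w). gamma_kernel z u * gamma_kernel c (w - u)) \<in> borel_measurable (lborel \<Otimes>\<^sub>M lborel)"
      by measurable
    show "has_bochner_integral lborel (\<lambda>w. gamma_kernel z u * gamma_kernel c (w - u))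
        (gamma_kernel z u * Gamma c)" for u
      by (intro has_bochner_integral_mult_right shift)
    show "(\<integral>w. norm (gamma_kernel z u * gamma_kernel c (w - u)) \<partial>lborel)
        = norm (gamma_kernel z u) * (\<integral>w. norm (gamma_kernel c w) \<partial>lborel)" for u
      by (simp add: norm_mult shift_norm)
  qed (rule has_bochner_integral_gamma_kernel[OF assms(1)])
  then have "(\<integral>w. gamma_kernel (z + c) w * (\<integral>t. beta_kernel z c t \<partial>lborel) \<partial>lborel) = Gamma z * Gamma c"
    unfolding gamma_kernel_convolution by (simp add: has_bochner_integral_iff)
  moreover have "integral\<^sup>L lborel (gamma_kernel (z + c)) = Gamma (z + c)"
    using has_bochner_integral_gamma_kernel[of "z + c"] assms by (simp add: has_bochner_integral_iff)
  ultimately have *: "Gamma (z + c) * (\<integral>t. beta_kernel z c t \<partial>lborel) = Gamma z * Gamma c"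
    by simp
  have "Gamma (z + c) \<noteq> 0" using assms by (intro Gamma_nonzero_right_half_plane) simp
  with * have "integral\<^sup>L lborel (beta_kernel z c) = Beta z c"
    by (simp add: Beta_def field_simps)
  then show ?thesis
    using integrable_beta_kernel[OF assms] by (simp add: has_bochner_integral_iff)
qed

section \<open>Mellin transforms of the weights\<close>

definition has_mellin :: "(real \<Rightarrow> real) \<Rightarrow> complex \<Rightarrow> complex \<Rightarrow> bool" where
  "has_mellin f s v \<longleftrightarrow>
     has_bochner_integral lborel (\<lambda>x. of_real (f x) * of_real x powr (s - 1)) v"

text \<open>The support condition makes the whole-line integral in \<open>has_mellin\<close> agree
  with the integral over (0,1), whatever value \<open>powr\<close> takes at bases x \<le> 0.
  Measurability is carried along for Fubini.\<close>

definition unit_supported :: "(real \<Rightarrow> real) \<Rightarrow> bool" where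
  "unit_supported f \<longleftrightarrow> f \<in> borel_measurable borel \<and> (\<forall>x. x \<notin> {0<..<1} \<longrightarrow> f x = 0)"

lemma unit_supported_beta_fun: "unit_supported (beta_fun a b)"
proof -
  have "beta_fun a b \<in> borel_measurable borel"
    unfolding beta_fun_def by measurable
  then show ?thesis by (auto simp: unit_supported_def beta_fun_def)
qed

text \<open>The integrand is a Beta integrand with parameters s + a and b - a. The factor Gamma(b -
  a) in its Beta value cancels the normalisation of \<open>beta_fun\<close>, and the parameters add
  up to s + b.\<close>

lemma has_mellin_beta_fun:
  assumes "a < b" "Re s > - a"
  shows "has_mellin (beta_fun a b) s (Gamma (s + of_real a) / Gamma (s + of_real b))"
proof -
  let ?z = "s + of_real a" and ?c = "complex_of_real (b - a)"
  have eq: "of_real (beta_fun a b x) * of_real x powr (s - 1) = beta_kernel ?z ?c x / Gamma ?c" for x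
  proof (cases "0 < x \<and> x < 1")
    case True
    have "of_real x powr (?z - 1) = complex_of_real x powr ((s - 1) + of_real a)"
      by (simp add: algebra_simps)
    also have "\<dots> = of_real x powr (s - 1) * of_real (x powr a)"
      using True by (subst powr_add) (simp add: powr_of_real)
    finally have "of_real x powr (?z - 1) = of_real x powr (s - 1) * of_real (x powr a)" .
    moreover have "of_real (1 - x) powr (of_real (b - a - 1)) = complex_of_real ((1 - x) powr (b - a - 1))"
      using True by (intro powr_of_real) simp
    moreover have "?c - 1 = of_real (b - a - 1)" by simp
    ultimately have "beta_kernel ?z ?c x
        = of_real x powr (s - 1) * of_real (x powr a) * complex_of_real ((1 - x) powr (b - a - 1))"
      using True by (simp only: beta_kernel_def) simp
    then show ?thesis using True
      by (simp only: beta_fun_def Gamma_complex_of_real) simp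
  qed (auto simp: beta_fun_def beta_kernel_def)
  have "Gamma ?c \<noteq> 0" using assms by (intro Gamma_nonzero_right_half_plane) simp
  then have "Beta ?z ?c / Gamma ?c = Gamma (s + of_real a) / Gamma (s + of_real b)"
    by (simp only: Beta_def add.assoc flip: of_real_add) simp
  moreover have "has_bochner_integral lborel (\<lambda>x. beta_kernel ?z ?c x / Gamma ?c) (Beta ?z ?c / Gamma ?c)"
    using assms by (intro has_bochner_integral_divide_zero has_bochner_integral_beta_kernel) auto
  ultimately show ?thesis
    unfolding has_mellin_def eq by (simp only:)
qed

text \<open>A nonzero integrand at t needs 0 < t < 1 and 0 < x/t < 1, hence 0 < x < t < 1.\<close>

lemma unit_supported_mellin_conv:
  assumes f: "unit_supported f" and g: "unit_supported g"
  shows "unit_supported (mellin_conv f g)"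
  unfolding unit_supported_def
proof (intro conjI allI impI)
  have [measurable]: "f \<in> borel_measurable borel" "g \<in> borel_measurable borel"
    using f g by (auto simp: unit_supported_def)
  show "mellin_conv f g \<in> borel_measurable borel"
    unfolding mellin_conv_def set_lebesgue_integral_def by measurable
next
  fix x :: real assume x: "x \<notin> {0<..<1}"
  have "f t * g (x / t) / t = 0" if "t > 0" for t
  proof (cases "t < 1")
    case True
    then have "x / t \<notin> {0<..<1}" using x that by (auto simp: field_simps)
    then show ?thesis using g by (simp add: unit_supported_def)
  next
    case False
    then show ?thesis using f by (simp add: unit_supported_def)
  qed
  then have "indicator {0<..} t *\<^sub>R (f t * g (x / t) / t) = 0" for t
    by (auto simp: indicator_def)
  then show "mellin_conv f g x = 0"
    unfolding mellin_conv_def set_lebesgue_integral_def by (simp only:) simp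
qed

text \<open>The power of x splits into the same powers of t and of x/t, so the integrand is
  \<phi>(t) \<psi>(x/t) / t. For fixed t > 0, substituting x = t y makes the integral over x equal
  to \<phi>(t) w.\<close>

lemma has_mellin_mellin_conv:
  assumes f: "unit_supported f" and g: "unit_supported g"
    and F: "has_mellin f s v" and G: "has_mellin g s w"
  shows "has_mellin (mellin_conv f g) s (v * w)"
proof -
  have [measurable]: "f \<in> borel_measurable borel" "g \<in> borel_measurable borel"
    using f g by (auto simp: unit_supported_def)
  have f0: "f t = 0" if "t \<le> 0" for t
    using f that by (simp add: unit_supported_def)
  have g0: "g t = 0" if "t \<le> 0" for t
    using g that by (simp add: unit_supported_def)
  define \<phi> where "\<phi> = (\<lambda>t. complex_of_real (f t) * of_real t powr (s - 1))"
  define \<psi> where "\<psi> = (\<lambda>t. complex_of_real (g t) * of_real t powr (s - 1))"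
  have [measurable]: "\<psi> \<in> borel_measurable borel" "\<phi> \<in> borel_measurable borel"
    unfolding \<psi>_def \<phi>_def by measurable
  have \<phi>: "has_bochner_integral lborel \<phi> v" and \<psi>: "has_bochner_integral lborel \<psi> w"
    using F G by (simp_all add: has_mellin_def \<phi>_def \<psi>_def)
  have "has_bochner_integral lborel (\<lambda>x. \<integral>t. \<phi> t * (\<psi> (x / t) / of_real t) \<partial>lborel) (v * w)"
  proof (rule has_bochner_integral_Fubini[OF _ _ _ \<phi>])
    show "(\<lambda>(t, x). \<phi> t * (\<psi> (x / t) / of_real t)) \<in> borel_measurable (lborel \<Otimes>\<^sub>M lborel)"
      by measurable
    fix t :: real
    show "has_bochner_integral lborel (\<lambda>x. \<phi> t * (\<psi> (x / t) / of_real t)) (\<phi> t * w)"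
    proof (cases "t > 0")
      case True
      have "has_bochner_integral lborel (\<lambda>x. \<psi> (x / t)) (w * of_real t)"
        using lborel_has_bochner_integral_real_affine_iff[of "1 / t" \<psi> w 0] \<psi> True
        by (simp add: scaleR_conv_of_real mult_ac)
      then have "has_bochner_integral lborel (\<lambda>x. \<psi> (x / t) / of_real t) (w * of_real t / of_real t)"
        by (rule has_bochner_integral_divide_zero)
      then show ?thesis using True by (intro has_bochner_integral_mult_right) simp
    qed (simp add: \<phi>_def f0 has_bochner_integral_zero)
    show "(\<integral>x. norm (\<phi> t * (\<psi> (x / t) / of_real t)) \<partial>lborel)
        = norm (\<phi> t) * (\<integral>x. norm (\<psi> x) \<partial>lborel)"
    proof (cases "t > 0")
      case True
      then show ?thesis
        using lborel_integral_real_affine[of "1 / t" "\<lambda>x. norm (\<psi> x)" 0]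
        by (simp add: norm_mult norm_divide)
    qed (simp add: \<phi>_def f0)
  qed
  moreover have "(\<integral>t. \<phi> t * (\<psi> (x / t) / of_real t) \<partial>lborel)
      = of_real (mellin_conv f g x) * of_real x powr (s - 1)" for x
  proof -
    have "\<phi> t * (\<psi> (x / t) / of_real t)
        = of_real (indicator {0<..} t *\<^sub>R (f t * g (x / t) / t)) * of_real x powr (s - 1)" for t
    proof (cases "t > 0 \<and> x > 0")
      case True
      then have "complex_of_real x powr (s - 1) = of_real t powr (s - 1) * of_real (x / t) powr (s - 1)"
        by (subst powr_times_real [symmetric]) auto
      then show ?thesis using True by (simp add: \<phi>_def \<psi>_def)
    next
      case False
      then have "t \<le> 0 \<or> t > 0 \<and> x / t \<le> 0" by (auto simp: field_simps)
      then show ?thesis by (auto simp: \<phi>_def \<psi>_def f0 g0)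
    qed
    then show ?thesis
      unfolding mellin_conv_def set_lebesgue_integral_def
      by (simp only: integral_mult_left_zero integral_complex_of_real)
  qed
  ultimately show ?thesis
    by (simp add: has_mellin_def)
qed

lemma weight0_Suc:
  assumes "r \<ge> 1"
  shows "weight0 (Suc r) a b = mellin_conv (weight0 r a b) (beta_fun (a (Suc r)) (b (Suc r)))"
  using assms by (simp add: weight0_def)

lemma unit_supported_weight0: "r \<ge> 1 \<Longrightarrow> unit_supported (weight0 r a b)"
proof (induction r rule: nat_induct_at_least)
  case base
  show ?case by (simp add: weight0_def unit_supported_beta_fun)
next
  case (Suc r)
  then show ?case by (simp add: weight0_Suc unit_supported_mellin_conv unit_supported_beta_fun)
qed

lemma has_mellin_weight0:
  assumes "r \<ge> 1" "\<And>j. j \<in> {1..r} \<Longrightarrow> a j < b j" "\<And>j. j \<in> {1..r} \<Longrightarrow> Re s > - a j"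
  shows "has_mellin (weight0 r a b) s
    (\<Prod>j=1..r. Gamma (s + of_real (a j)) / Gamma (s + of_real (b j)))"
  using assms
proof (induction r rule: nat_induct_at_least)
  case base
  then show ?case by (simp add: weight0_def has_mellin_beta_fun)
next
  case (Suc r)
  have "has_mellin (mellin_conv (weight0 r a b) (beta_fun (a (Suc r)) (b (Suc r)))) s
      ((\<Prod>j=1..r. Gamma (s + of_real (a j)) / Gamma (s + of_real (b j)))
        * (Gamma (s + of_real (a (Suc r))) / Gamma (s + of_real (b (Suc r)))))"
    using Suc by (intro has_mellin_mellin_conv unit_supported_weight0 unit_supported_beta_fun
        has_mellin_beta_fun) auto
  then show ?case using Suc.hyps by (simp add: weight0_Suc)
qed

section \<open>Polynomial functions with a degree bound\<close>

definition poly_fun :: "nat \<Rightarrow> (complex \<Rightarrow> complex) \<Rightarrow> bool" where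
  "poly_fun m f \<longleftrightarrow> (\<exists>p. degree p \<le> m \<and> f = poly p)"

lemma poly_fun_const: "poly_fun 0 (\<lambda>s. c)"
  unfolding poly_fun_def by (intro exI[of _ "[:c:]"]) (auto simp: fun_eq_iff)

lemma poly_fun_mult: "poly_fun m f \<Longrightarrow> poly_fun n g \<Longrightarrow> poly_fun (m + n) (\<lambda>s. f s * g s)"
  unfolding poly_fun_def
  by (elim exE conjE, rule_tac x = "p * pa" in exI)
    (auto simp: fun_eq_iff intro: order_trans[OF degree_mult_le])

lemma poly_fun_cmult: "poly_fun m f \<Longrightarrow> poly_fun m (\<lambda>s. c * f s)"
  using poly_fun_mult[OF poly_fun_const] by simp

lemma poly_fun_sum:
  assumes "\<And>i. i \<in> I \<Longrightarrow> poly_fun m (f i)"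
  shows "poly_fun m (\<lambda>s. \<Sum>i\<in>I. f i s)"
proof -
  obtain p where p: "\<And>i. i \<in> I \<Longrightarrow> degree (p i) \<le> m \<and> f i = poly (p i)"
    using assms unfolding poly_fun_def by metis
  show ?thesis unfolding poly_fun_def
  proof (intro exI conjI)
    show "degree (\<Sum>i\<in>I. p i) \<le> m"
      by (cases "finite I") (use p in \<open>auto intro!: degree_sum_le\<close>)
    show "(\<lambda>s. \<Sum>i\<in>I. f i s) = poly (\<Sum>i\<in>I. p i)"
      using p by (simp add: poly_sum fun_eq_iff)
  qed
qed

lemma poly_fun_prod:
  assumes "finite I" "\<And>i. i \<in> I \<Longrightarrow> poly_fun (m i) (f i)"
  shows "poly_fun (\<Sum>i\<in>I. m i) (\<lambda>s. \<Prod>i\<in>I. f i s)"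
  using assms
  by (induction I rule: finite_induct) (simp_all add: poly_fun_const poly_fun_mult)

lemma poly_fun_linear: "poly_fun 1 (\<lambda>s. c + d * s)"
  unfolding poly_fun_def by (intro exI[of _ "[:c, d:]"]) (auto simp: fun_eq_iff)

text \<open>The slope \<open>d\<close> is kept general: d = -1 is the factor in 1 - s of the final
  formula, and d = 1 gives the factors produced by Gamma shifts.\<close>

lemma poly_fun_pochhammer: "poly_fun m (\<lambda>s. pochhammer (c + d * s) m)"
proof (induction m)
  case (Suc m)
  then show ?case
    using poly_fun_mult[OF Suc poly_fun_linear[of "c + of_nat m" d]]
    by (simp add: pochhammer_Suc algebra_simps)
qed (simp add: poly_fun_const)

text \<open>Both sides are polynomials of degree at most m that agree at the m + 1 points 0, ..., m:
  both vanish at 1, ..., m, and at 0 the Pochhammer symbol is m!, which fixes the constant.\<close>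

lemma poly_fun_vanishing:
  assumes "poly_fun m f" "\<And>k. k \<in> {1..m} \<Longrightarrow> f (of_nat k) = 0"
  shows "f s = f 0 / fact m * pochhammer (1 - s) m"
proof -
  obtain p where p: "degree p \<le> m" "f = poly p"
    using assms(1) unfolding poly_fun_def by auto
  obtain q where q: "degree q \<le> m" "(\<lambda>s. f 0 / fact m * pochhammer (1 - s) m) = poly q"
    using poly_fun_cmult[OF poly_fun_pochhammer[of m 1 "-1"], of "f 0 / fact m"]
    unfolding poly_fun_def by auto
  have "p = q"
  proof (rule poly_eqI_degree)
    have card: "card (of_nat ` {0..m} :: complex set) = Suc m"
      by (subst card_image) (auto simp: inj_on_def)
    show "degree p < card (of_nat ` {0..m} :: complex set)"
      "degree q < card (of_nat ` {0..m} :: complex set)"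
      using p q unfolding card by auto
    fix x :: complex assume "x \<in> of_nat ` {0..m}"
    then obtain k where k: "k \<le> m" "x = of_nat k" by auto
    have "f x = f 0 / fact m * pochhammer (1 - x) m"
    proof (cases "k = 0")
      case True
      then show ?thesis using k by (simp add: pochhammer_fact [symmetric])
    next
      case False
      \<comment> \<open>The factor of index k - 1 is (1 - k) + (k - 1) = 0, and k - 1 < m.\<close>
      then have "pochhammer (1 - x) m = 0"
        using k unfolding pochhammer_eq_0_iff by (intro exI[of _ "k - 1"]) auto
      then show ?thesis using assms(2)[of k] k False by simp
    qed
    then show "poly p x = poly q x"
      using p(2) q(2) by metis
  qed
  then show ?thesis using p(2) q(2) by metis
qed

section \<open>Integer shifts in Gamma quotients\<close>

lemma Gamma_plus_of_nat:
  fixes z :: complex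
  assumes "Re z > 0"
  shows "Gamma (z + of_nat m) = pochhammer z m * Gamma z"
proof -
  have "z \<notin> \<int>\<^sub>\<le>\<^sub>0"
    using Gamma_nonzero_right_half_plane[OF assms] by (simp add: Gamma_eq_zero_iff)
  then show ?thesis
    using pochhammer_Gamma[of z m] Gamma_nonzero_right_half_plane[OF assms] by simp
qed

text \<open>Here k comes from the factor \<open>x ^ k\<close> and d from the unit vector added to b
  in \<open>weight\<close>. The numerator is lowered to s + a and the denominator raised to s + b +
  n, so that all terms share one quotient; k + d \<le> n makes the second shift go upwards.\<close>

lemma Gamma_quotient_shift:
  fixes a b s :: complex
  assumes "Re (s + a) > 0" "Re (s + b) > 0" "k + d \<le> n"
  shows "Gamma (s + of_nat k + a) / Gamma (s + of_nat k + (b + of_nat d))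
    = Gamma (s + a) / Gamma (s + b + of_nat n)
      * (pochhammer (s + a) k * pochhammer (s + b + of_nat (k + d)) (n - (k + d)))"
proof -
  have "Gamma (s + a + of_nat k) = pochhammer (s + a) k * Gamma (s + a)"
    using assms by (intro Gamma_plus_of_nat)
  then have *: "Gamma (s + of_nat k + a) = pochhammer (s + a) k * Gamma (s + a)"
    by (simp add: add_ac)
  have "Gamma (s + b + of_nat (k + d) + of_nat (n - (k + d)))
      = pochhammer (s + b + of_nat (k + d)) (n - (k + d)) * Gamma (s + b + of_nat (k + d))"
    using assms by (intro Gamma_plus_of_nat) auto
  moreover have "s + b + of_nat (k + d) + of_nat (n - (k + d)) = s + b + of_nat n"
    using assms(3) by (simp only: add.assoc flip: of_nat_add) simp
  ultimately have **: "Gamma (s + b + of_nat n)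
      = pochhammer (s + b + of_nat (k + d)) (n - (k + d)) * Gamma (s + b + of_nat (k + d))"
    by (simp only:)
  have "Gamma (s + b + of_nat n) \<noteq> 0" "Gamma (s + b + of_nat (k + d)) \<noteq> 0"
    using assms by (auto intro!: Gamma_nonzero_right_half_plane)
  moreover have "s + of_nat k + (b + of_nat d) = s + b + of_nat (k + d)"
    by (simp add: algebra_simps)
  ultimately show ?thesis
    unfolding * by (simp only:) (use ** in \<open>simp add: field_simps\<close>)
qed

section \<open>Mellin transforms of polynomial combinations of functions\<close>

lemma has_mellin_power_mult:
  assumes "unit_supported f" "has_mellin f (s + of_nat k) v"
  shows "has_mellin (\<lambda>x. x ^ k * f x) s v"
proof -
  have "of_real (x ^ k * f x) * of_real x powr (s - 1)
      = of_real (f x) * complex_of_real x powr (s + of_nat k - 1)" for x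
  proof (cases "x > 0")
    case True
    have "complex_of_real x powr (s + of_nat k - 1) = of_real x powr ((s - 1) + of_nat k)"
      by (simp add: algebra_simps)
    also have "\<dots> = of_real x powr (s - 1) * of_real x ^ k"
      using True by (subst powr_add) (simp add: powr_nat)
    finally show ?thesis by simp
  next
    case False
    then have "f x = 0" using assms(1) by (simp add: unit_supported_def)
    then show ?thesis by simp
  qed
  then show ?thesis using assms(2) by (simp only: has_mellin_def)
qed

lemma has_mellin_cmult: "has_mellin f s v \<Longrightarrow> has_mellin (\<lambda>x. c * f x) s (of_real c * v)"
  unfolding has_mellin_def
  using has_bochner_integral_mult_right[of "of_real c" lborel "\<lambda>x. of_real (f x) * of_real x powr (s - 1)" v]
  by (simp add: mult.assoc)

lemma has_mellin_sum:
  "(\<And>i. i \<in> I \<Longrightarrow> has_mellin (f i) s (v i)) \<Longrightarrow> has_mellin (\<lambda>x. \<Sum>i\<in>I. f i x) s (\<Sum>i\<in>I. v i)"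
  unfolding has_mellin_def of_real_sum sum_distrib_right by (rule has_bochner_integral_sum)

text \<open>Two functions occur because a type I function is prescribed only on (0,1);
  \<open>f\<close> is a representative that vanishes elsewhere.\<close>

lemma has_mellin_imp_has_mellin_transform_at:
  assumes "has_mellin f s v" "\<And>x. x \<notin> {0<..<1} \<Longrightarrow> f x = 0" "\<And>x. x \<in> {0<..<1} \<Longrightarrow> F x = f x"
  shows "has_mellin_transform_at F s v"
proof -
  have "indicator {0<..<1} x *\<^sub>R (complex_of_real (F x) * complex_of_real x powr (s - 1))
      = of_real (f x) * of_real x powr (s - 1)" for x
    using assms(2,3)[of x] by (cases "x \<in> {0<..<1}") auto
  then show ?thesis
    using assms(1)
    by (simp add: has_mellin_transform_at_def set_integrable_def set_lebesgue_integral_def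
        has_mellin_def has_bochner_integral_iff)
qed

text \<open>At s = k + 1 the transform is the k-th moment; this is how the orthogonality conditions
  enter.\<close>

lemma has_mellin_transform_at_of_nat:
  assumes "has_mellin_transform_at F (of_nat (Suc k)) v"
  shows "v = of_real (LINT x:{0<..<1}|lborel. F x * x ^ k)"
proof -
  have eq: "indicator {0<..<1} x *\<^sub>R (complex_of_real (F x) * complex_of_real x powr (of_nat (Suc k) - 1))
      = of_real (indicator {0<..<1} x *\<^sub>R (F x * x ^ k))" for x
    by (cases "x \<in> {0<..<1}") (auto simp: powr_nat)
  show ?thesis
    using assms unfolding has_mellin_transform_at_def set_lebesgue_integral_def eq
    by (simp only: integral_complex_of_real)
qed

lemma poly_eq_sum_lessThan:
  fixes p :: "'a :: comm_semiring_1 poly"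
  assumes "p = 0 \<or> degree p < n"
  shows "poly p x = (\<Sum>k<n. coeff p k * x ^ k)"
proof (cases "p = 0")
  case False
  then have "degree p < n" using assms by simp
  then show ?thesis
    unfolding poly_altdef by (intro sum.mono_neutral_left) (auto simp: coeff_eq_0 not_le)
qed simp

section \<open>The Mellin transform of a type I function\<close>

theorem theorem2p6:
  fixes r :: nat and a b :: "nat \<Rightarrow> real" and n :: "nat \<Rightarrow> nat" and F :: "real \<Rightarrow> real"
  assumes "r \<ge> 1"
    and "\<And>j. j \<in> {1..r} \<Longrightarrow> a j > -1"
    and "\<And>j. j \<in> {1..r} \<Longrightarrow> b j > -1"
    and "\<And>j. j \<in> {1..r} \<Longrightarrow> a j < b j"
    and "near_diagonal r n"
    and "multi_size r n \<ge> 1"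
    and "type_I_function r (weight r a b) n F"
  shows "\<exists>C :: real. \<forall>s :: complex. Re s > - Min (a ` {1..r}) \<longrightarrow>
    has_mellin_transform_at F s
      (complex_of_real C *
       ((\<Prod>j=1..r. Gamma (s + complex_of_real (a j))) /
        (\<Prod>j=1..r. Gamma (s + complex_of_real (b j) + of_nat (n j)))) *
       pochhammer (1 - s) (multi_size r n - 1))"
proof -
  define N where "N = multi_size r n"
  obtain A where A: "\<And>j. j \<in> {1..r} \<Longrightarrow> A j = 0 \<or> degree (A j) < n j"
    and F: "\<And>x. x \<in> {0<..<1} \<Longrightarrow> F x = (\<Sum>j=1..r. poly (A j) x * weight r a b j x)"
    and orth: "\<And>k. k + 2 \<le> N \<Longrightarrow> (LINT x:{0<..<1}|lborel. F x * x ^ k) = 0"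
    using assms(7) unfolding type_I_function_def N_def by blast
  define \<delta> :: "nat \<Rightarrow> nat \<Rightarrow> nat" where "\<delta> i j = (if i = j then 1 else 0)" for i j
  \<comment> \<open>\<open>G\<close> is the quotient common to all terms, and \<open>T j k\<close>
    the polynomial that remains for \<open>x ^ k\<close> times the j-th weight.\<close>
  define G where "G s = (\<Prod>i=1..r. Gamma (s + of_real (a i))) /
      (\<Prod>i=1..r. Gamma (s + of_real (b i) + of_nat (n i)))" for s :: complex
  define T where "T j k s = (\<Prod>i=1..r. pochhammer (s + of_real (a i)) k
      * pochhammer (s + of_real (b i) + of_nat (k + \<delta> i j)) (n i - (k + \<delta> i j)))" for j k and s :: complex
  define P where "P s = (\<Sum>j=1..r. \<Sum>k<n j. of_real (coeff (A j) k) * T j k s)" for s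
  define f where "f x = (\<Sum>j=1..r. \<Sum>k<n j. coeff (A j) k * (x ^ k * weight r a b j x))" for x
  have a: "Re (s + of_real (a i)) > 0" if "Re s > - Min (a ` {1..r})" "i \<in> {1..r}" for s i
  proof -
    have "Min (a ` {1..r}) \<le> a i" using that by (intro Min_le) auto
    then have "- a i < Re s" using that(1) by linarith
    then show ?thesis by simp
  qed
  \<comment> \<open>For i = j this is k < n_j; otherwise k \<le> n_j - 1 \<le> n_i.\<close>
  have bound: "k + \<delta> i j \<le> n i" if "i \<in> {1..r}" "j \<in> {1..r}" "k < n j" for i j k
    using assms(5) that by (force simp: near_diagonal_def \<delta>_def)
  have supp: "unit_supported (weight r a b j)" for j
    unfolding weight_def using assms(1) by (rule unit_supported_weight0)
  have mellin_T: "has_mellin (\<lambda>x. x ^ k * weight r a b j x) s (G s * T j k s)"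
    if s: "Re s > - Min (a ` {1..r})" and j: "j \<in> {1..r}" and k: "k < n j" for s j k
  proof (rule has_mellin_power_mult[OF supp])
    let ?b = "b(j := b j + 1)"
    have "has_mellin (weight r a b j) (s + of_nat k)
        (\<Prod>i=1..r. Gamma (s + of_nat k + of_real (a i)) / Gamma (s + of_nat k + of_real (?b i)))"
      unfolding weight_def
    proof (rule has_mellin_weight0)
      fix i assume i: "i \<in> {1..r}"
      show "a i < ?b i" using assms(4)[OF i] by auto
      show "- a i < Re (s + of_nat k)" using a[OF s i] by simp
    qed (rule assms(1))
    also have "(\<Prod>i=1..r. Gamma (s + of_nat k + of_real (a i)) / Gamma (s + of_nat k + of_real (?b i)))
      = (\<Prod>i=1..r. Gamma (s + of_real (a i)) / Gamma (s + of_real (b i) + of_nat (n i))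
          * (pochhammer (s + of_real (a i)) k
            * pochhammer (s + of_real (b i) + of_nat (k + \<delta> i j)) (n i - (k + \<delta> i j))))"
    proof (rule prod.cong[OF refl])
      fix i assume i: "i \<in> {1..r}"
      have eq: "complex_of_real (?b i) = of_real (b i) + of_nat (\<delta> i j)"
        by (simp add: \<delta>_def)
      show "Gamma (s + of_nat k + of_real (a i)) / Gamma (s + of_nat k + of_real (?b i))
        = Gamma (s + of_real (a i)) / Gamma (s + of_real (b i) + of_nat (n i))
          * (pochhammer (s + of_real (a i)) k
            * pochhammer (s + of_real (b i) + of_nat (k + \<delta> i j)) (n i - (k + \<delta> i j)))"
        unfolding eq
        using a[OF s i] assms(4)[OF i] bound[OF i j k] by (intro Gamma_quotient_shift) auto
    qed
    also have "\<dots> = G s * T j k s"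
      by (simp only: prod.distrib prod_dividef G_def T_def)
    finally show "has_mellin (weight r a b j) (s + of_nat k) (G s * T j k s)" .
  qed
  have mellin_F: "has_mellin_transform_at F s (G s * P s)" if s: "Re s > - Min (a ` {1..r})" for s
  proof (rule has_mellin_imp_has_mellin_transform_at)
    have "has_mellin f s (\<Sum>j=1..r. \<Sum>k<n j. of_real (coeff (A j) k) * (G s * T j k s))"
      unfolding f_def using s by (intro has_mellin_sum has_mellin_cmult mellin_T) auto
    also have "(\<Sum>j=1..r. \<Sum>k<n j. of_real (coeff (A j) k) * (G s * T j k s)) = G s * P s"
      by (simp add: P_def sum_distrib_left mult_ac)
    finally show "has_mellin f s (G s * P s)" .
    show "f x = 0" if "x \<notin> {0<..<1}" for x
      using supp that by (simp add: f_def unit_supported_def)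
    show "F x = f x" if "x \<in> {0<..<1}" for x
      unfolding F[OF that] f_def
      by (intro sum.cong refl) (simp add: poly_eq_sum_lessThan[OF A] sum_distrib_right mult.assoc)
  qed
  have vanish: "P (of_nat k) = 0" if k: "k \<in> {1..N - 1}" for k
  proof -
    \<comment> \<open>This puts every positive integer in the half-plane where the transform is
      known.\<close>
    have "Min (a ` {1..r}) > - 1"
      using assms(1,2) by (subst Min_gr_iff) auto
    then have "- Min (a ` {1..r}) < 1" by linarith
    then have s: "Re (of_nat k) > - Min (a ` {1..r})" using k by auto
    obtain k' where k': "k = Suc k'" using k by (cases k) auto
    have "G (of_nat k) * P (of_nat k) = of_real (LINT x:{0<..<1}|lborel. F x * x ^ k')"
      using mellin_F[OF s] unfolding k' by (rule has_mellin_transform_at_of_nat)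
    \<comment> \<open>From k = k' + 1 \<le> N - 1 follows k' + 2 \<le> N, the range of
      orthogonality.\<close>
    also have "\<dots> = 0" using orth[of k'] k k' by simp
    finally have "G (of_nat k) * P (of_nat k) = 0" .
    \<comment> \<open>The denominator must be nonzero as well, since division by 0 would make
      \<open>G\<close> equal to 0.\<close>
    moreover have "Re (of_nat k + of_real (b i) + of_nat (n i)) > 0" if "i \<in> {1..r}" for i
      using a[OF s that] assms(4)[OF that] by simp
    then have "G (of_nat k) \<noteq> 0"
      using a[OF s] by (simp add: G_def Gamma_nonzero_right_half_plane)
    ultimately show ?thesis by simp
  qed
  have pochhammer_s: "poly_fun m (\<lambda>s. pochhammer (s + c) m)" for m c
    using poly_fun_pochhammer[of m c 1] by (simp add: add.commute)
  have "poly_fun (N - 1) P"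
    unfolding P_def
  proof (intro poly_fun_sum poly_fun_cmult)
    fix j k assume j: "j \<in> {1..r}" and "k \<in> {..<n j}"
    then have k: "k < n j" by simp
    have "poly_fun (\<Sum>i=1..r. k + (n i - (k + \<delta> i j))) (T j k)"
      unfolding T_def add.assoc
      by (intro poly_fun_prod poly_fun_mult pochhammer_s finite_atLeastAtMost)
    \<comment> \<open>The i-th factor has degree at most n_i - \<delta>_ij, and exactly one
      \<delta>_ij is 1, so the degrees sum to N - 1. Adding the \<delta>_ij back avoids truncated
      subtraction.\<close>
    moreover have "(\<Sum>i=1..r. k + (n i - (k + \<delta> i j))) + (\<Sum>i=1..r. \<delta> i j) = N"
      unfolding N_def multi_size_def sum.distrib [symmetric]
    proof (rule sum.cong[OF refl])
      fix i assume "i \<in> {1..r}"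
      from bound[OF this j k] show "k + (n i - (k + \<delta> i j)) + \<delta> i j = n i" by linarith
    qed
    moreover have "(\<Sum>i=1..r. \<delta> i j) = 1" using j by (simp add: \<delta>_def)
    ultimately show "poly_fun (N - 1) (T j k)"
      by (metis add_diff_cancel_right')
  qed
  then have P: "P s = P 0 / fact (N - 1) * pochhammer (1 - s) (N - 1)" for s
    using vanish by (rule poly_fun_vanishing)
  \<comment> \<open>The constant is P(0)/(N - 1)!. It is real because at s = 0 all Pochhammer
    symbols have real arguments; \<open>P\<close> is defined there even if 0 lies outside the
    half-plane.\<close>
  have "pochhammer (complex_of_real x) k \<in> \<real>" for x k
    by (simp add: pochhammer_of_real)
  then have "pochhammer (0 + complex_of_real x) k \<in> \<real>"
    "pochhammer (0 + complex_of_real x + of_nat m) k \<in> \<real>" for x k m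
    by (metis add_0, metis add_0 of_real_add of_real_of_nat_eq)
  then have "T j k 0 \<in> \<real>" for j k
    unfolding T_def by (intro prod_in_Reals Reals_mult)
  moreover have "complex_of_real (fact (N - 1)) \<in> \<real>" by (rule Reals_of_real)
  ultimately have "P 0 / fact (N - 1) \<in> \<real>"
    unfolding P_def by (intro Reals_divide sum_in_Reals Reals_mult) auto
  then obtain C where C: "P 0 / fact (N - 1) = of_real C"
    by (auto elim: Reals_cases)
  show ?thesis
  proof (intro exI[of _ C] allI impI)
    fix s :: complex assume "Re s > - Min (a ` {1..r})"
    from mellin_F[OF this] show "has_mellin_transform_at F s
      (complex_of_real C *
       ((\<Prod>j=1..r. Gamma (s + complex_of_real (a j))) /
        (\<Prod>j=1..r. Gamma (s + complex_of_real (b j) + of_nat (n j)))) *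
       pochhammer (1 - s) (multi_size r n - 1))"
      unfolding P[of s] C unfolding G_def N_def by (simp only: mult_ac)
  qed
qed

end
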